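(* Let $N = {n+d \choose d}$ and let $\alpha=\{k_1,\ldots,k_g\}$ be a partition of $N$. A real polynomial $p(x)$ in $n$ variables and of degree $2d$ belongs to $\alpha\text{-}\mathit{SDSOS}_{n,2d}$ if and only if it admits a representation $p(x) = v_d(x)^{\mathsf T} Q\, v_d(x)$ with $Q \in \mathcal{FW}^N_{\alpha, 2}$.
   Context: $\mathbb{S}^m_+$ denotes the real symmetric PSD $m\times m$ matrices. A partition of $N$ is an ordered list $\alpha=\{k_1,\ldots,k_g\}$ of positive integers with $\sum_{i=1}^g k_i=N$; throughout $g\ge 2$. Let $E_i^\alpha\in\mathbb{R}^{k_i\times N}$ be the $i$-th block row of $I_N$ when the rows of $I_N$ are split consecutively into blocks of sizes $k_1,\ldots,k_g$, and for $i\neq j$ let $E_{ij}^\alpha=\begin{bmatrix}(E_i^\alpha)^{\mathsf T} & (E_j^\alpha)^{\mathsf T}\end{bmatrix}^{\mathsf T}\in\mathbb{R}^{(k_i+k_j)\times N}$. The set $\mathcal{FW}_{\alpha,2}^N$ of block factor-width-two matrices consists of all symmetric $Z\in\mathbb{R}^{N\times N}$ of the form $Z=\sum_{1\le i<j\le g} (E^{\alpha}_{ij})^{\mathsf T} X_{ij} E^{\alpha}_{ij}$ for some $X_{ij}\in\mathbb{S}^{k_i+k_j}_+$. $v_d(x) = [ 1,x_1,x_2,\ldots,x_n,x_1^2,x_1x_2,\ldots,x_n^d ]^{\mathsf T}$ is the vector of all $N$ monomials in $x\in\mathbb{R}^n$ of degree at most $d$. A polynomial $p(x)$ in $n$ variables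 and of degree $2d$ (understood as degree at most $2d$) is in $\alpha\text{-}\mathit{SDSOS}_{n,2d}$ if it can be represented as $$p(x) = \sum_{1 \leq i < j \leq g}\left(\sum_{t=1}^{k_i + k_j} \left(f_{ij,t}^{\mathsf T} m_{ij}(x)\right)^2\right)$$ for some $f_{ij,t}\in\mathbb{R}^{k_i+k_j}$, where $m_{ij}(x)=E_{ij}^\alpha v_d(x)$ is the subvector of $v_d(x)$ of length $k_i+k_j$ formed by its $i$-th and $j$-th blocks. *)

theory Defs
  imports Complex_Main "HOL-Library.Poly_Mapping" "Jordan_Normal_Form.Matrix"
begin


text \<open>
  Formal polynomials, with multiplication the convolution product: a monomial is a finitely
  supported map from variable indices to exponents, and the variables are numbered from 0,
  so the variables of an \<open>n\<close>-variate polynomial are \<open>0, ..., n - 1\<close>.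
\<close>

type_synonym monomial = "nat \<Rightarrow>\<^sub>0 nat"
type_synonym real_mpoly = "monomial \<Rightarrow>\<^sub>0 real"

definition total_degree :: "monomial \<Rightarrow> nat" where
  "total_degree m = (\<Sum>i\<in>Poly_Mapping.keys m. Poly_Mapping.lookup m i)"

definition monomials_upto :: "nat \<Rightarrow> nat \<Rightarrow> monomial set" where
  "monomials_upto n d = {m. Poly_Mapping.keys m \<subseteq> {..<n} \<and> total_degree m \<le> d}"

definition polys_upto :: "nat \<Rightarrow> nat \<Rightarrow> real_mpoly set" where
  "polys_upto n d = {p. Poly_Mapping.keys p \<subseteq> monomials_upto n d}"

definition const_poly :: "real \<Rightarrow> real_mpoly" where
  "const_poly c = Poly_Mapping.single 0 c"

definition monom_poly :: "monomial \<Rightarrow> real_mpoly" where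
  "monom_poly m = Poly_Mapping.single m 1"

text \<open>
  Exponent vectors of length \<open>n\<close> and sum \<open>k\<close>, in decreasing lexicographic order. For
  \<open>n = 2\<close> and \<open>k = 2\<close> this is \<open>[[2,0],[1,1],[0,2]]\<close>, that is, the order
  of \<open>x1^2, x1*x2, x2^2\<close>.
\<close>

fun exponents :: "nat \<Rightarrow> nat \<Rightarrow> nat list list" where
  "exponents 0 k = (if k = 0 then [[]] else [])"
| "exponents (Suc n) k =
     concat (map (\<lambda>e. map ((#) e) (exponents n (k - e))) (rev [0..<Suc k]))"

definition monomial_list :: "nat \<Rightarrow> nat \<Rightarrow> monomial list" where
  "monomial_list n d = map Poly_Mapping.nth (concat (map (exponents n) [0..<Suc d]))"

definition monomial_vec :: "nat \<Rightarrow> nat \<Rightarrow> real_mpoly vec" where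
  "monomial_vec n d = vec_of_list (map monom_poly (monomial_list n d))"



definition is_partition :: "nat list \<Rightarrow> nat \<Rightarrow> bool" where
  "is_partition \<alpha> N \<longleftrightarrow> (\<forall>k\<in>set \<alpha>. k > 0) \<and> sum_list \<alpha> = N"

text \<open>Blocks are numbered from 0. The rows of block \<open>i\<close> start at row
  \<open>sum_list (take i \<alpha>)\<close> of the identity matrix.\<close>

definition block_row :: "nat list \<Rightarrow> nat \<Rightarrow> real mat" where
  "block_row \<alpha> i =
     mat (\<alpha> ! i) (sum_list \<alpha>) (\<lambda>(r, c). 1\<^sub>m (sum_list \<alpha>) $$ (sum_list (take i \<alpha>) + r, c))"

definition block_rows :: "nat list \<Rightarrow> nat \<Rightarrow> nat \<Rightarrow> real mat" where
  "block_rows \<alpha> i j = block_row \<alpha> i @\<^sub>r block_row \<alpha> j"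

definition block_pairs :: "nat list \<Rightarrow> (nat \<times> nat) set" where
  "block_pairs \<alpha> = {(i, j). i < j \<and> j < length \<alpha>}"

definition psd_mats :: "nat \<Rightarrow> real mat set" where
  "psd_mats m = {A \<in> carrier_mat m m. A\<^sup>T = A \<and> (\<forall>x\<in>carrier_vec m. x \<bullet> (A *\<^sub>v x) \<ge> 0)}"

text \<open>The sum of matrices is taken entrywise, since matrices of unspecified dimension
  have no neutral element of addition.\<close>

definition FW2 :: "nat list \<Rightarrow> nat \<Rightarrow> real mat set" where
  "FW2 \<alpha> N = {Z \<in> carrier_mat N N. Z\<^sup>T = Z \<and>
     (\<exists>X. (\<forall>(i, j)\<in>block_pairs \<alpha>. X i j \<in> psd_mats (\<alpha> ! i + \<alpha> ! j)) \<and>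
       Z = mat N N (\<lambda>rc. \<Sum>(i, j)\<in>block_pairs \<alpha>.
             ((block_rows \<alpha> i j)\<^sup>T * X i j * block_rows \<alpha> i j) $$ rc))}"



definition block_monomials :: "nat list \<Rightarrow> nat \<Rightarrow> nat \<Rightarrow> nat \<Rightarrow> nat \<Rightarrow> real_mpoly vec" where
  "block_monomials \<alpha> n d i j = map_mat const_poly (block_rows \<alpha> i j) *\<^sub>v monomial_vec n d"

definition SDSOS :: "nat list \<Rightarrow> nat \<Rightarrow> nat \<Rightarrow> real_mpoly set" where
  "SDSOS \<alpha> n d = {p \<in> polys_upto n (2 * d).
     \<exists>f. (\<forall>(i, j)\<in>block_pairs \<alpha>. \<forall>t<\<alpha> ! i + \<alpha> ! j. f i j t \<in> carrier_vec (\<alpha> ! i + \<alpha> ! j)) \<and>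
       p = (\<Sum>(i, j)\<in>block_pairs \<alpha>. \<Sum>t<\<alpha> ! i + \<alpha> ! j.
             (map_vec const_poly (f i j t) \<bullet> block_monomials \<alpha> n d i j)\<^sup>2)}"

definition gram_poly :: "nat \<Rightarrow> nat \<Rightarrow> real mat \<Rightarrow> real_mpoly" where
  "gram_poly n d Q = monomial_vec n d \<bullet> (map_mat const_poly Q *\<^sub>v monomial_vec n d)"



lemma set_exponents: "set (exponents n k) = {e. length e = n \<and> sum_list e = k}"
proof (induction n arbitrary: k)
  case 0
  then show ?case by auto
next
  case (Suc n)
  show ?case
  proof (intro equalityI subsetI)
    fix e assume "e \<in> set (exponents (Suc n) k)"
    then show "e \<in> {e. length e = Suc n \<and> sum_list e = k}"
      by (auto simp: Suc)
  next
    fix e assume "e \<in> {e. length e = Suc n \<and> sum_list e = k}"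
    then obtain a e' where "e = a # e'" "length e' = n" "a + sum_list e' = k"
      by (cases e) auto
    then have "e' \<in> set (exponents n (k - a))" "a \<in> set (rev [0..<Suc k])"
      by (auto simp: Suc)
    moreover from this have "a \<le> k" by auto
    ultimately show "e \<in> set (exponents (Suc n) k)"
      using \<open>e = a # e'\<close> by (auto simp: Suc)
  qed
qed

lemma distinct_exponents: "distinct (exponents n k)"
proof (induction n arbitrary: k)
  case (Suc n)
  have "distinct (concat (map (\<lambda>e. map ((#) e) (exponents n (k - e))) es))" if "distinct es" for es
    using that by (induction es) (auto simp: distinct_map Suc)
  then show ?case by (simp only: exponents.simps distinct_rev distinct_upt)
qed simp

lemma sum_list_exponents_nth:
  "sum_list e = total_degree (Poly_Mapping.nth e)"
proof -
  have "Poly_Mapping.keys (Poly_Mapping.nth e) \<subseteq> {..<length e}"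
    by (auto simp: in_keys_iff nth.rep_eq nth_default_def simp del: keys_nth split: if_splits)
  then have "total_degree (Poly_Mapping.nth e) = (\<Sum>i<length e. Poly_Mapping.lookup (Poly_Mapping.nth e) i)"
    unfolding total_degree_def by (intro sum.mono_neutral_left) (auto simp: in_keys_iff simp del: keys_nth)
  then show ?thesis
    by (simp add: nth.rep_eq nth_default_def sum_list_sum_nth atLeast0LessThan)
qed

lemma set_monomial_list: "set (monomial_list n d) = monomials_upto n d"
proof (intro equalityI subsetI)
  fix m assume "m \<in> set (monomial_list n d)"
  then obtain e where e: "m = Poly_Mapping.nth e" "length e = n" "sum_list e \<le> d"
    by (auto simp: monomial_list_def set_exponents)
  have "Poly_Mapping.keys m \<subseteq> {..<n}"
    using e by (auto simp: in_keys_iff nth.rep_eq nth_default_def simp del: keys_nth split: if_splits)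
  then show "m \<in> monomials_upto n d"
    using e by (simp add: monomials_upto_def sum_list_exponents_nth)
next
  fix m assume m: "m \<in> monomials_upto n d"
  define e where "e = map (Poly_Mapping.lookup m) [0..<n]"
  have "Poly_Mapping.nth e = m"
    using m by (intro poly_mapping_eqI)
      (auto simp: e_def nth.rep_eq nth_default_def monomials_upto_def in_keys_iff)
  moreover from this have "sum_list e \<le> d"
    using m by (simp add: sum_list_exponents_nth monomials_upto_def)
  moreover have "length e = n" by (simp add: e_def)
  ultimately have "e \<in> set (concat (map (exponents n) [0..<Suc d]))"
    by (auto simp: set_exponents)
  then show "m \<in> set (monomial_list n d)"
    unfolding monomial_list_def set_map using \<open>Poly_Mapping.nth e = m\<close> by blast
qed

lemma distinct_monomial_list: "distinct (monomial_list n d)"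
proof -
  have "distinct (concat (map (exponents n) ks))" if "distinct ks" for ks
    using that by (induction ks) (auto simp: distinct_exponents set_exponents)
  then have "distinct (concat (map (exponents n) [0..<Suc d]))" by (simp only: distinct_upt)
  moreover have "inj_on Poly_Mapping.nth (set (concat (map (exponents n) [0..<Suc d])))"
  proof (rule inj_onI)
    fix e e' :: "nat list"
    assume "e \<in> set (concat (map (exponents n) [0..<Suc d]))"
      and "e' \<in> set (concat (map (exponents n) [0..<Suc d]))"
      and eq: "Poly_Mapping.nth e = Poly_Mapping.nth e'"
    then have len: "length e = n" "length e' = n" by (auto simp: set_exponents)
    show "e = e'"
    proof (rule nth_equalityI)
      fix i assume "i < length e"
      moreover have "nth_default 0 e i = nth_default 0 e' i"
        using eq by (metis nth.rep_eq)
      ultimately show "e ! i = e' ! i" using len by (simp add: nth_default_def)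
    qed (simp add: len)
  qed
  ultimately show ?thesis by (simp only: monomial_list_def distinct_map simp_thms)
qed

lemma length_exponents_Suc: "length (exponents (Suc n) k) = (\<Sum>e\<le>k. length (exponents n e))"
proof -
  have "length (exponents (Suc n) k) = (\<Sum>e\<le>k. length (exponents n (k - e)))"
    by (simp add: length_concat comp_def rev_map[symmetric] sum_list_rev interv_sum_list_conv_sum_set_nat
        atLeast0LessThan lessThan_Suc_atMost[symmetric] del: upt_Suc sum.lessThan_Suc)
  also have "\<dots> = (\<Sum>e\<le>k. length (exponents n e))"
    by (rule sum.nat_diff_reindex[where n = "Suc k", simplified lessThan_Suc_atMost, simplified])
  finally show ?thesis .
qed

lemma length_exponents: "length (exponents (Suc n) k) = (n + k) choose k"
proof (induction n arbitrary: k)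
  case 0
  have "length (exponents 0 e) = (if e = 0 then 1 else 0)" for e by simp
  then show ?case by (simp only: length_exponents_Suc) simp
next
  case (Suc n)
  then show ?case by (subst length_exponents_Suc) (simp only: sum_choose_lower, simp)
qed

lemma length_monomial_list: "length (monomial_list n d) = (n + d) choose d"
proof -
  have "length (monomial_list n d) = (\<Sum>k\<le>d. length (exponents n k))"
    by (simp add: monomial_list_def length_concat comp_def interv_sum_list_conv_sum_set_nat
        atLeast0LessThan lessThan_Suc_atMost[symmetric] del: upt_Suc sum.lessThan_Suc)
  also have "\<dots> = length (exponents (Suc n) d)" by (simp only: length_exponents_Suc)
  finally show ?thesis by (simp only: length_exponents)
qed

lemma monomial_vec_carrier: "monomial_vec n d \<in> carrier_vec ((n + d) choose d)"
  unfolding monomial_vec_def by (rule carrier_vecI) (simp add: length_monomial_list)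

end

theory Submission
  imports Defs
begin

text \<open>
  A matrix is positive semidefinite iff it has the form \<open>F\<^sup>T F\<close> with \<open>F\<close> square, and
  \<open>w\<^sup>T F\<^sup>T F w\<close> is the sum of the squares of the entries of \<open>F w\<close>. Applied with
  \<open>w = E\<^sub>i\<^sub>j v\<^sub>d\<close>, this turns each block of squares into the Gram polynomial of
  \<open>E\<^sub>i\<^sub>j\<^sup>T X\<^sub>i\<^sub>j E\<^sub>i\<^sub>j\<close>, and the Gram polynomial is additive in the matrix.
\<close>

section \<open>Gram factorization of positive semidefinite matrices\<close>

text \<open>By symmetry the last row and the last column contribute equal cross terms, hence the
  factor 2. This exhibits the form as a quadratic polynomial in the last coordinate
  \<open>y n\<close>.\<close>

lemma sum_quadratic_form_Suc:
  fixes A :: "nat \<Rightarrow> nat \<Rightarrow> real"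
  assumes "\<And>i. i < n \<Longrightarrow> A n i = A i n"
  shows "(\<Sum>i<Suc n. \<Sum>j<Suc n. y i * A i j * y j) =
    (\<Sum>i<n. \<Sum>j<n. y i * A i j * y j) + 2 * y n * (\<Sum>i<n. y i * A i n) + (y n)\<^sup>2 * A n n"
proof -
  have "(\<Sum>j<n. y n * A n j * y j) = y n * (\<Sum>i<n. y i * A i n)"
    unfolding sum_distrib_left by (rule sum.cong) (auto simp: assms)
  moreover have "(\<Sum>i<n. y i * A i n * y n) = y n * (\<Sum>i<n. y i * A i n)"
    unfolding sum_distrib_left by (rule sum.cong) auto
  ultimately show ?thesis
    by (simp add: sum.distrib power2_eq_square)
qed

text \<open>In the induction step the last index is eliminated by a Schur complement. If the last
  diagonal entry vanishes, so does its column, and the formulas remain correct because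
  \<open>x / 0 = 0\<close>.\<close>

lemma psd_gram_factorization:
  fixes A :: "nat \<Rightarrow> nat \<Rightarrow> real"
  assumes "\<And>i j. i < n \<Longrightarrow> j < n \<Longrightarrow> A i j = A j i"
    and "\<And>x. (\<Sum>i<n. \<Sum>j<n. x i * A i j * x j) \<ge> 0"
  shows "\<exists>F. \<forall>i<n. \<forall>j<n. A i j = (\<Sum>t<n. F t i * F t j)"
  using assms
proof (induction n arbitrary: A)
  case (Suc n)
  define a where "a = A n n"
  \<comment> \<open>Evaluating the form at \<open>x(n := s)\<close> leaves \<open>s\<close> free;
    the later inequalities are instances of this one for suitable \<open>x\<close> and
    \<open>s\<close>.\<close>
  have nonneg: "(\<Sum>i<n. \<Sum>j<n. x i * A i j * x j) + 2 * s * (\<Sum>i<n. x i * A i n) + s\<^sup>2 * a \<ge> 0"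
    for x s
  proof -
    have "(\<Sum>i<Suc n. \<Sum>j<Suc n. (x(n := s)) i * A i j * (x(n := s)) j) \<ge> 0"
      by (rule Suc.prems(2))
    then show ?thesis
      by (subst (asm) sum_quadratic_form_Suc) (auto simp: a_def Suc.prems(1))
  qed
  have "a \<ge> 0" using nonneg[of "\<lambda>_. 0" 1] by simp
  have col: "A k n = 0" if "a = 0" "k < n" for k
  proof (rule ccontr)
    assume "A k n \<noteq> 0"
    \<comment> \<open>At the \<open>k\<close>-th unit vector the bound is affine in \<open>s\<close>
      with slope \<open>2 * A k n\<close>. The value of \<open>s\<close> chosen below makes it equal
      to -1.\<close>
    let ?e = "\<lambda>i. of_bool (i = k) :: real"
    have "(\<Sum>i<n. ?e i * A i n) = A k n"
      "(\<Sum>i<n. \<Sum>j<n. ?e i * A i j * ?e j) = A k k"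
      using that(2) by (simp_all add: of_bool_def if_distrib[of "\<lambda>c. c * _"]
          if_distrib[of "\<lambda>c. _ * c"] sum.delta cong: if_cong)
    then have "A k k + 2 * s * A k n \<ge> 0" for s
      using nonneg[of ?e s] that(1) by simp
    from this[of "- (A k k + 1) / (2 * A k n)"] \<open>A k n \<noteq> 0\<close> show False
      by (simp add: field_simps)
  qed
  define B where "B i j = A i j - A i n * A j n / a" for i j
  have "(\<Sum>i<n. \<Sum>j<n. x i * B i j * x j) \<ge> 0" for x
  proof -
    let ?b = "\<Sum>i<n. x i * A i n"
    have "(\<Sum>i<n. \<Sum>j<n. x i * B i j * x j) =
        (\<Sum>i<n. \<Sum>j<n. x i * A i j * x j) - (\<Sum>i<n. \<Sum>j<n. (x i * A i n) * (x j * A j n)) / a"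
      unfolding B_def sum_divide_distrib sum_subtractf[symmetric]
      by (intro sum.cong refl) (simp add: algebra_simps)
    also have "\<dots> = (\<Sum>i<n. \<Sum>j<n. x i * A i j * x j) - ?b\<^sup>2 / a"
      by (simp add: sum_product power2_eq_square)
    \<comment> \<open>For \<open>a > 0\<close> the value \<open>s = - ?b / a\<close> minimizes the
      quadratic in \<open>s\<close>, and the minimum is the form of the Schur complement
      \<open>B\<close>.\<close>
    also have "\<dots> = (\<Sum>i<n. \<Sum>j<n. x i * A i j * x j) + 2 * (- ?b / a) * ?b + (- ?b / a)\<^sup>2 * a"
      by (cases "a = 0") (simp_all add: field_simps power2_eq_square)
    also have "\<dots> \<ge> 0" by (rule nonneg)
    finally show ?thesis .
  qed
  moreover have "B i j = B j i" if "i < n" "j < n" for i j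
    using that Suc.prems(1)[of i j] by (simp add: B_def mult.commute)
  ultimately obtain F where F: "\<And>i j. i < n \<Longrightarrow> j < n \<Longrightarrow> B i j = (\<Sum>t<n. F t i * F t j)"
    using Suc.IH[of B] by blast
  \<comment> \<open>\<open>G\<close> extends \<open>F\<close> by a zero column and by the last
    column of \<open>A\<close>, scaled by \<open>1 / sqrt a\<close>, as new row. Its Gram matrix is
    that of \<open>F\<close> plus the rank-one term subtracted in \<open>B\<close>.\<close>
  define G where "G t i = (if t = n then A i n / sqrt a else if i = n then 0 else F t i)" for t i
  have "A i j = (\<Sum>t<Suc n. G t i * G t j)" if "i < Suc n" "j < Suc n" for i j
  proof -
    have "(\<Sum>t<n. G t i * G t j) = (if i = n \<or> j = n then 0 else B i j)"
      using that by (auto simp: G_def F intro!: sum.cong)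
    moreover have "G n i * G n j = A i n * A j n / a"
      using \<open>a \<ge> 0\<close> by (simp add: G_def)
    moreover have "A i j = A j i" using Suc.prems(1) that by blast
    ultimately show ?thesis
      using that col by (cases "a = 0") (auto simp: B_def a_def less_Suc_eq)
  qed
  then show ?case by blast
qed simp

text \<open>That \<open>F\<close> can be taken square matters: its rows will be the coefficient
  vectors of a block pair, and \<open>SDSOS\<close> allows exactly as many squares as these vectors
  have entries.\<close>

lemma psd_mats_eq_gram: "psd_mats m = {F\<^sup>T * F | F. F \<in> carrier_mat m m}"
proof (intro equalityI subsetI)
  fix X assume X: "X \<in> psd_mats m"
  then have dim: "X \<in> carrier_mat m m" and sym: "X\<^sup>T = X"
    and nonneg: "\<And>x. x \<in> carrier_vec m \<Longrightarrow> x \<bullet> (X *\<^sub>v x) \<ge> 0"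
    by (auto simp: psd_mats_def)
  have "X $$ (i, j) = X $$ (j, i)" if "i < m" "j < m" for i j
    using arg_cong[OF sym, of "\<lambda>M. M $$ (j, i)"] dim that by simp
  moreover have "(\<Sum>i<m. \<Sum>j<m. x i * X $$ (i, j) * x j) \<ge> 0" for x
    using nonneg[of "vec m x"] dim
    by (simp add: scalar_prod_def sum_distrib_left atLeast0LessThan mult.assoc)
  ultimately obtain F where F: "\<forall>i<m. \<forall>j<m. X $$ (i, j) = (\<Sum>t<m. F t i * F t j)"
    using psd_gram_factorization[of m "\<lambda>i j. X $$ (i, j)"] by blast
  define M where "M = mat m m (\<lambda>(t, i). F t i)"
  have "X = M\<^sup>T * M"
    using dim F by (intro eq_matI) (auto simp: M_def scalar_prod_def atLeast0LessThan)
  moreover have "M \<in> carrier_mat m m" by (simp add: M_def)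
  ultimately show "X \<in> {F\<^sup>T * F | F. F \<in> carrier_mat m m}" by blast
next
  fix X :: "real mat" assume "X \<in> {F\<^sup>T * F | F. F \<in> carrier_mat m m}"
  then obtain F where F: "F \<in> carrier_mat m m" "X = F\<^sup>T * F" by blast
  have "x \<bullet> (X *\<^sub>v x) = (F *\<^sub>v x) \<bullet> (F *\<^sub>v x)" if "x \<in> carrier_vec m" for x
    using F that by (simp add: transpose_vec_mult_scalar[of "F\<^sup>T" m m, simplified])
  moreover have "v \<bullet> v \<ge> 0" for v :: "real vec"
    by (simp add: scalar_prod_def sum_nonneg)
  ultimately show "X \<in> psd_mats m"
    using F by (simp add: psd_mats_def transpose_mult[of _ m m])
qed

section \<open>Quadratic forms evaluated at vectors of polynomials\<close>

text \<open>Supplies the transfer of real matrix products and finite sums to matrices of constant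
  polynomials.\<close>

interpretation const_poly: comm_semiring_hom const_poly
  by unfold_locales
    (simp_all add: const_poly_def single_add mult_single)

lemma scalar_prod_transpose_mult:
  fixes A :: "'a :: comm_semiring_0 mat"
  assumes "A \<in> carrier_mat nr nc" "u \<in> carrier_vec nc" "w \<in> carrier_vec nr"
  shows "u \<bullet> (A\<^sup>T *\<^sub>v w) = (A *\<^sub>v u) \<bullet> w"
  using transpose_vec_mult_scalar[of "A\<^sup>T" nc nr w u] assms by simp

text \<open>Each squared linear form is an entry of \<open>?C *\<^sub>v w\<close>, so the sum is the
  scalar product of that vector with itself; moving one factor across by transposition gives the
  Gram form.\<close>

lemma sum_squares_eq_gram:
  assumes F: "F \<in> carrier_mat m k" and w: "w \<in> carrier_vec k"
  shows "(\<Sum>t<m. (map_vec const_poly (row F t) \<bullet> w)\<^sup>2) =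
    w \<bullet> (map_mat const_poly (F\<^sup>T * F) *\<^sub>v w)"
proof -
  let ?C = "map_mat const_poly F"
  have C: "?C \<in> carrier_mat m k" using F by simp
  have "map_mat const_poly (F\<^sup>T * F) = ?C\<^sup>T * ?C"
    using F by (simp add: const_poly.mat_hom_mult[of _ k m] map_mat_transpose)
  then have "w \<bullet> (map_mat const_poly (F\<^sup>T * F) *\<^sub>v w) = (?C *\<^sub>v w) \<bullet> (?C *\<^sub>v w)"
    using C w by (simp add: scalar_prod_transpose_mult[of _ m k])
  moreover have "row ?C t = map_vec const_poly (row F t)" if "t < m" for t
    using F that by (intro eq_vecI) auto
  then have "(?C *\<^sub>v w) \<bullet> (?C *\<^sub>v w) = (\<Sum>t<m. (map_vec const_poly (row F t) \<bullet> w)\<^sup>2)"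
    using F by (simp add: scalar_prod_def[of "_ *\<^sub>v _"] atLeast0LessThan power2_eq_square)
  ultimately show ?thesis by simp
qed

text \<open>Congruence by \<open>E\<close> amounts to substituting \<open>E v\<close> for
  \<open>v\<close>. With a block selector as \<open>E\<close>, the full monomial vector is replaced
  by its subvector.\<close>

lemma gram_congruence:
  assumes E: "E \<in> carrier_mat m N" and X: "X \<in> carrier_mat m m"
    and v: "v \<in> carrier_vec N"
  shows "v \<bullet> (map_mat const_poly (E\<^sup>T * X * E) *\<^sub>v v) =
    (map_mat const_poly E *\<^sub>v v) \<bullet> (map_mat const_poly X *\<^sub>v (map_mat const_poly E *\<^sub>v v))"
proof -
  let ?E = "map_mat const_poly E" and ?X = "map_mat const_poly X"
  have C: "?E \<in> carrier_mat m N" "?X \<in> carrier_mat m m" using E X by simp_all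
  have "map_mat const_poly (E\<^sup>T * X * E) = ?E\<^sup>T * ?X * ?E"
    using E X const_poly.mat_hom_mult[of "E\<^sup>T * X" N m E N]
      const_poly.mat_hom_mult[of "E\<^sup>T" N m X m]
    by (simp only: map_mat_transpose mult_carrier_mat[of _ N m] transpose_carrier_mat)
  moreover have "(?E\<^sup>T * ?X * ?E) *\<^sub>v v = ?E\<^sup>T *\<^sub>v (?X *\<^sub>v (?E *\<^sub>v v))"
    using C v mult_carrier_mat[of "?E\<^sup>T" N m ?X m]
    by (simp add: assoc_mult_mat_vec[of "?E\<^sup>T * ?X" N m ?E N]
        assoc_mult_mat_vec[of "?E\<^sup>T" N m ?X m]
        del: assoc_mult_mat)
  ultimately show ?thesis
    using C v by (simp add: scalar_prod_transpose_mult[of _ m N])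
qed

text \<open>The matrix sum is entrywise, as in \<open>FW2\<close>, so additivity is obtained by
  expanding into entries and exchanging the sums.\<close>

lemma gram_sum:
  assumes "v \<in> carrier_vec N" and "\<And>s. s \<in> S \<Longrightarrow> M s \<in> carrier_mat N N"
  shows "v \<bullet> (map_mat const_poly (mat N N (\<lambda>rc. \<Sum>s\<in>S. M s $$ rc)) *\<^sub>v v) =
    (\<Sum>s\<in>S. v \<bullet> (map_mat const_poly (M s) *\<^sub>v v))"
proof -
  have expand: "v \<bullet> (map_mat const_poly Q *\<^sub>v v) =
      (\<Sum>r<N. \<Sum>c<N. v $ r * const_poly (Q $$ (r, c)) * v $ c)" if "Q \<in> carrier_mat N N" for Q
    using that assms(1)
    by (simp add: scalar_prod_def sum_distrib_left atLeast0LessThan mult.assoc)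
  have "v \<bullet> (map_mat const_poly (mat N N (\<lambda>rc. \<Sum>s\<in>S. M s $$ rc)) *\<^sub>v v) =
      (\<Sum>r<N. \<Sum>c<N. \<Sum>s\<in>S. v $ r * const_poly (M s $$ (r, c)) * v $ c)"
    by (subst expand) (simp_all add: const_poly.hom_sum sum_distrib_left sum_distrib_right)
  also have "\<dots> = (\<Sum>r<N. \<Sum>s\<in>S. \<Sum>c<N. v $ r * const_poly (M s $$ (r, c)) * v $ c)"
    by (intro sum.cong refl sum.swap)
  also have "\<dots> = (\<Sum>s\<in>S. \<Sum>r<N. \<Sum>c<N. v $ r * const_poly (M s $$ (r, c)) * v $ c)"
    by (rule sum.swap)
  also have "\<dots> = (\<Sum>s\<in>S. v \<bullet> (map_mat const_poly (M s) *\<^sub>v v))"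
    by (intro sum.cong refl expand[symmetric] assms(2))
  finally show ?thesis .
qed

section \<open>Block sums and the equivalence\<close>

lemma block_rows_carrier: "block_rows \<alpha> i j \<in> carrier_mat (\<alpha> ! i + \<alpha> ! j) (sum_list \<alpha>)"
  unfolding block_rows_def by (rule carrier_append_rows) (simp_all add: block_row_def)

text \<open>The common identity behind both directions: \<open>X\<close> may be defined from given
  factors \<open>F\<close>, or \<open>F\<close> may be chosen as factors of a given
  \<open>X\<close>.\<close>

lemma gram_poly_block_sum:
  assumes N: "sum_list \<alpha> = (n + d) choose d"
    and F: "\<And>i j. (i, j) \<in> block_pairs \<alpha> \<Longrightarrow>
      F i j \<in> carrier_mat (\<alpha> ! i + \<alpha> ! j) (\<alpha> ! i + \<alpha> ! j)"
    and X: "\<And>i j. (i, j) \<in> block_pairs \<alpha> \<Longrightarrow> X i j = (F i j)\<^sup>T * F i j"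
  shows "gram_poly n d (mat (sum_list \<alpha>) (sum_list \<alpha>) (\<lambda>rc. \<Sum>(i, j)\<in>block_pairs \<alpha>.
      ((block_rows \<alpha> i j)\<^sup>T * X i j * block_rows \<alpha> i j) $$ rc)) =
    (\<Sum>(i, j)\<in>block_pairs \<alpha>. \<Sum>t<\<alpha> ! i + \<alpha> ! j.
      (map_vec const_poly (row (F i j) t) \<bullet> block_monomials \<alpha> n d i j)\<^sup>2)"
proof -
  let ?N = "sum_list \<alpha>" and ?E = "block_rows \<alpha>" and ?v = "monomial_vec n d"
  let ?M = "\<lambda>(i, j). (?E i j)\<^sup>T * X i j * ?E i j"
  have v: "?v \<in> carrier_vec ?N" using monomial_vec_carrier N by simp
  note E = block_rows_carrier[of \<alpha>]
  have Xc: "X i j \<in> carrier_mat (\<alpha> ! i + \<alpha> ! j) (\<alpha> ! i + \<alpha> ! j)" if "(i, j) \<in> block_pairs \<alpha>" for i j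
    using F[OF that] X[OF that] by simp
  have M: "?M s \<in> carrier_mat ?N ?N" if "s \<in> block_pairs \<alpha>" for s
  proof -
    obtain i j where "s = (i, j)" by (cases s)
    then show ?thesis
      using E[of i j] mult_carrier_mat[OF mult_carrier_mat[OF _ Xc[of i j]] E[of i j]] that
      by auto
  qed
  have "gram_poly n d (mat ?N ?N (\<lambda>rc. \<Sum>s\<in>block_pairs \<alpha>. ?M s $$ rc)) =
      (\<Sum>s\<in>block_pairs \<alpha>. ?v \<bullet> (map_mat const_poly (?M s) *\<^sub>v ?v))"
    unfolding gram_poly_def using v M by (rule gram_sum)
  also have "\<dots> = (\<Sum>(i, j)\<in>block_pairs \<alpha>. \<Sum>t<\<alpha> ! i + \<alpha> ! j.
      (map_vec const_poly (row (F i j) t) \<bullet> block_monomials \<alpha> n d i j)\<^sup>2)"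
  proof (intro sum.cong refl, clarify)
    fix i j assume ij: "(i, j) \<in> block_pairs \<alpha>"
    have "block_monomials \<alpha> n d i j \<in> carrier_vec (\<alpha> ! i + \<alpha> ! j)"
      unfolding block_monomials_def using E[of i j] v
      by (intro mult_mat_vec_carrier[of _ _ ?N]) simp_all
    with F[OF ij] show "?v \<bullet> (map_mat const_poly ((?E i j)\<^sup>T * X i j * ?E i j) *\<^sub>v ?v) =
        (\<Sum>t<\<alpha> ! i + \<alpha> ! j.
          (map_vec const_poly (row (F i j) t) \<bullet> block_monomials \<alpha> n d i j)\<^sup>2)"
      by (simp only: gram_congruence[OF E Xc[OF ij] v] sum_squares_eq_gram
          block_monomials_def[symmetric] X[OF ij, symmetric])
  qed
  finally show ?thesis by (simp add: case_prod_unfold)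
qed

text \<open>The symmetry demanded by \<open>FW2\<close> is inherited from the blocks, because
  transposing \<open>E\<^sup>T * X * E\<close> only transposes \<open>X\<close>.\<close>

lemma FW2_memI:
  assumes X: "\<And>i j. (i, j) \<in> block_pairs \<alpha> \<Longrightarrow> X i j \<in> psd_mats (\<alpha> ! i + \<alpha> ! j)"
  shows "mat (sum_list \<alpha>) (sum_list \<alpha>) (\<lambda>rc. \<Sum>(i, j)\<in>block_pairs \<alpha>.
    ((block_rows \<alpha> i j)\<^sup>T * X i j * block_rows \<alpha> i j) $$ rc) \<in> FW2 \<alpha> (sum_list \<alpha>)"
    (is "?Z \<in> _")
proof -
  let ?N = "sum_list \<alpha>"
  have "((block_rows \<alpha> i j)\<^sup>T * X i j * block_rows \<alpha> i j) $$ (c, r) =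
      ((block_rows \<alpha> i j)\<^sup>T * X i j * block_rows \<alpha> i j) $$ (r, c)"
    if ij: "(i, j) \<in> block_pairs \<alpha>" and rc: "r < ?N" "c < ?N" for i j r c
  proof -
    let ?E = "block_rows \<alpha> i j" and ?m = "\<alpha> ! i + \<alpha> ! j"
    have E: "?E \<in> carrier_mat ?m ?N" by (rule block_rows_carrier)
    have Xc: "X i j \<in> carrier_mat ?m ?m" and sym: "(X i j)\<^sup>T = X i j"
      using X[OF ij] by (auto simp: psd_mats_def)
    have "(?E\<^sup>T * X i j * ?E)\<^sup>T = ?E\<^sup>T * X i j * ?E"
      using E Xc sym transpose_mult[of "?E\<^sup>T * X i j" ?N ?m ?E ?N]
        transpose_mult[of "?E\<^sup>T" ?N ?m "X i j" ?m]
        assoc_mult_mat[of "?E\<^sup>T" ?N ?m "X i j" ?m ?E ?N]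
      by (simp only: Matrix.transpose_transpose transpose_carrier_mat mult_carrier_mat[of _ ?N ?m])
    from arg_cong[OF this, of "\<lambda>M. M $$ (r, c)"] show ?thesis
      using E rc by simp
  qed
  then have "?Z\<^sup>T = ?Z"
    by (intro eq_matI) (auto intro!: sum.cong)
  then show ?thesis
    using X unfolding FW2_def by auto
qed

theorem theorem4:
  fixes n d N :: nat and \<alpha> :: "nat list" and p :: real_mpoly
  assumes "N = (n + d) choose d"
    and "is_partition \<alpha> N"
    and "length \<alpha> \<ge> 2"
    and "p \<in> polys_upto n (2 * d)"
  shows "p \<in> SDSOS \<alpha> n d \<longleftrightarrow> (\<exists>Q \<in> FW2 \<alpha> N. p = gram_poly n d Q)"
proof
  have N: "N = sum_list \<alpha>" "sum_list \<alpha> = (n + d) choose d"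
    using assms(1,2) by (auto simp: is_partition_def)
  let ?m = "\<lambda>i j. \<alpha> ! i + \<alpha> ! j"
  {
    assume "p \<in> SDSOS \<alpha> n d"
    then obtain f where
      f: "\<And>i j t. (i, j) \<in> block_pairs \<alpha> \<Longrightarrow> t < ?m i j \<Longrightarrow> f i j t \<in> carrier_vec (?m i j)"
      and p: "p = (\<Sum>(i, j)\<in>block_pairs \<alpha>. \<Sum>t<?m i j.
        (map_vec const_poly (f i j t) \<bullet> block_monomials \<alpha> n d i j)\<^sup>2)"
      unfolding SDSOS_def by blast
    \<comment> \<open>The given coefficient vectors become the rows of a square matrix.\<close>
    define F where "F i j = mat (?m i j) (?m i j) (\<lambda>(t, c). f i j t $ c)" for i j
    have F: "F i j \<in> carrier_mat (?m i j) (?m i j)" for i j by (simp add: F_def)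
    have "row (F i j) t = f i j t" if "(i, j) \<in> block_pairs \<alpha>" "t < ?m i j" for i j t
      using f[OF that] that(2) by (intro eq_vecI) (auto simp: F_def)
    then have "p = (\<Sum>(i, j)\<in>block_pairs \<alpha>. \<Sum>t<?m i j.
        (map_vec const_poly (row (F i j) t) \<bullet> block_monomials \<alpha> n d i j)\<^sup>2)"
      unfolding p by (auto intro!: sum.cong)
    \<comment> \<open>Here \<open>refl\<close> fixes \<open>X i j\<close> to be the Gram matrix of
      \<open>F i j\<close>.\<close>
    also note gram_poly_block_sum[OF N(2) F refl, symmetric]
    finally show "\<exists>Q\<in>FW2 \<alpha> N. p = gram_poly n d Q"
      unfolding N(1) using F by (intro bexI[OF _ FW2_memI]) (auto simp: psd_mats_eq_gram)
  next
    assume "\<exists>Q\<in>FW2 \<alpha> N. p = gram_poly n d Q"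
    then obtain X where X: "\<And>i j. (i, j) \<in> block_pairs \<alpha> \<Longrightarrow> X i j \<in> psd_mats (?m i j)"
      and p: "p = gram_poly n d (mat N N (\<lambda>rc. \<Sum>(i, j)\<in>block_pairs \<alpha>.
        ((block_rows \<alpha> i j)\<^sup>T * X i j * block_rows \<alpha> i j) $$ rc))"
      unfolding FW2_def by blast
    \<comment> \<open>The membership condition sits under the existential quantifier so that choice
      gives a total function \<open>F\<close>.\<close>
    from X have "\<forall>i j. \<exists>F. (i, j) \<in> block_pairs \<alpha> \<longrightarrow>
        F \<in> carrier_mat (?m i j) (?m i j) \<and> X i j = F\<^sup>T * F"
      unfolding psd_mats_eq_gram by blast
    then obtain F where F: "\<And>i j. (i, j) \<in> block_pairs \<alpha> \<Longrightarrow> F i j \<in> carrier_mat (?m i j) (?m i j)"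
      "\<And>i j. (i, j) \<in> block_pairs \<alpha> \<Longrightarrow> X i j = (F i j)\<^sup>T * F i j"
      by metis
    have "p = (\<Sum>(i, j)\<in>block_pairs \<alpha>. \<Sum>t<?m i j.
        (map_vec const_poly (row (F i j) t) \<bullet> block_monomials \<alpha> n d i j)\<^sup>2)"
      unfolding p N(1) using N(2) F by (rule gram_poly_block_sum)
    moreover have "\<forall>(i, j)\<in>block_pairs \<alpha>. \<forall>t<?m i j. row (F i j) t \<in> carrier_vec (?m i j)"
      using F(1) by auto
    \<comment> \<open>The rows of the factors are the required coefficient vectors; the degree bound
      is the assumption on \<open>p\<close>.\<close>
    ultimately show "p \<in> SDSOS \<alpha> n d"
      unfolding SDSOS_def using assms(4)
      by (auto intro!: exI[of _ "\<lambda>i j. row (F i j)"])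
  }
qed

end
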